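(* For every $\alpha\in\mathbb{N}$ and real $\rho>1$ there is a finite constant $C_{\alpha,\rho}$, depending only on $\alpha$ and $\rho$, such that the following holds for all real $\sigma\geq 0$ and all positive real numbers $C_{\Upsilon,1},\dots,C_{\Upsilon,\alpha}$. Let $\gamma_\emptyset=1$ and, for every nonempty finite $v\subseteq\mathbb{N}$, $$\gamma_v=\sum_{\boldsymbol{\nu}\in \{1,\dots,\alpha\}^{|v|}}(|\boldsymbol{\nu}|!)^{\sigma}\prod_{j\in v} \frac{C_{\Upsilon,\nu_j}}{j^{\nu_j\rho}},$$ and for real $m>0$ let $S_{\boldsymbol{\gamma}}(m)=\sum_{v\subseteq \mathbb{N}}\gamma_v m^{|v|}$. Then $S_{\boldsymbol{\gamma}}(m)<\infty$ for all $m> 0$ if and only if $\rho>\sigma$, in which case $$\liminf_{m\to\infty} m^{-\frac{1}{\rho-\sigma}}\log S_{\boldsymbol{\gamma}}(m)\geq (\rho-\sigma)C_{\Upsilon,1}^{\frac{1}{\rho-\sigma}}$$ and $$\limsup_{m\to\infty}m^{-\frac{1}{\rho-\sigma}}\log S_{\boldsymbol{\gamma}}(m)\leq (\rho-\sigma)\left(C_{\alpha,\rho}\max_{k\in \{1,\dots,\alpha\}}C_{\Upsilon,k}^{1/k} \right)^{\frac{1}{\rho-\sigma}}.$$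
   Context: $\mathbb{N}=\{1,2,3,\dots\}$. Sums over $v\subseteq\mathbb{N}$ run over all finite subsets of $\mathbb{N}$, including the empty set. For a finite set $v\subseteq\mathbb{N}$, a multi-index $\boldsymbol{\nu}\in\{1,\dots,\alpha\}^{|v|}$ is indexed by the elements of $v$, i.e. $\boldsymbol{\nu}=(\nu_j)_{j\in v}$ with each $\nu_j\in\{1,\dots,\alpha\}$, and $|\boldsymbol{\nu}|=\sum_{j\in v}\nu_j$. $\log$ is the natural logarithm. *)

theory Defs
  imports "HOL-Analysis.Analysis"
begin

(* A multi-index (nu_j) for j in v is an extensional function in PiE v. *)
definition weight :: "nat \<Rightarrow> real \<Rightarrow> real \<Rightarrow> (nat \<Rightarrow> real) \<Rightarrow> nat set \<Rightarrow> real" where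
  "weight \<alpha> \<rho> \<sigma> \<Upsilon> v =
     (if v = {} then 1
      else \<Sum>\<nu> \<in> PiE v (\<lambda>_. {1..\<alpha>}).
             (fact (\<Sum>j\<in>v. \<nu> j)) powr \<sigma> *
             (\<Prod>j\<in>v. \<Upsilon> (\<nu> j) / (real j powr (real (\<nu> j) * \<rho>))))"

(* The terms are nonnegative whenever m > 0 and all \<Upsilon> k > 0, so the sum is taken in
   [0,\<infinity>], where a divergent series has the value \<infinity>. *)
definition S_weight :: "nat \<Rightarrow> real \<Rightarrow> real \<Rightarrow> (nat \<Rightarrow> real) \<Rightarrow> real \<Rightarrow> ennreal" where
  "S_weight \<alpha> \<rho> \<sigma> \<Upsilon> m =
     (\<Sum>\<^sub>\<infinity>v \<in> {v. finite v \<and> v \<subseteq> {1..}}.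
        ennreal (weight \<alpha> \<rho> \<sigma> \<Upsilon> v * m ^ card v))"

end

(* With |nu| = n fixed, Cauchy's estimate at radius n^rho for the generating function
   prod_j (1 + z j^(-rho) + ... + (z j^(-rho))^alpha) bounds the coefficient sum by K^n (n!)^(-rho), where K
   depends only on alpha and rho. Hence S(m) is at most the sum over n of (K M m)^n / (n!)^(rho - sigma),
   with M the maximum in the statement; each term is at most 2^(-n) exp ((rho - sigma) (2 K M m)^(1/(rho - sigma))).
   For the lower bound the sets v = {1..n} with nu = (1,...,1) suffice: their terms are
   (m Upsilon_1)^n (n!)^(sigma - rho), and the largest of them is compared with an exponential series. *)
theory Submission
  imports Defs "HOL-Real_Asymp.Real_Asymp"
begin

section \<open>Bounds for powers, factorials and the product of the factors 1 + (n/j)^\<rho>\<close>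

text \<open>Discrete form of comparing (x + 1)^(-\<rho>) with the integral of t^(-\<rho>) over
  [x, x + 1]. With y = x / (x + 1) it reduces to y^(1 - \<rho>) >= 1 + (1 - \<rho>) (y - 1), which
  follows from ln y <= y - 1 and 1 + t <= exp t.\<close>

lemma powr_telescope:
  fixes x \<rho> :: real
  assumes x: "x > 0" and \<rho>: "\<rho> > 1"
  shows "(\<rho> - 1) * (x + 1) powr (- \<rho>) \<le> x powr (1 - \<rho>) - (x + 1) powr (1 - \<rho>)"
proof -
  define y where "y = x / (x + 1)"
  have y: "y > 0" "y - 1 = - 1 / (x + 1)" using x by (auto simp: y_def field_simps)
  have "1 + (\<rho> - 1) / (x + 1) = 1 + (1 - \<rho>) * (y - 1)"
    unfolding y(2) by (simp add: diff_divide_distrib)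
  also have "\<dots> \<le> 1 + (1 - \<rho>) * ln y"
    using ln_le_minus_one[OF y(1)] \<rho> by (simp add: mult_left_mono_neg)
  also have "\<dots> \<le> exp ((1 - \<rho>) * ln y)" by (rule exp_ge_add_one_self)
  also have "\<dots> = y powr (1 - \<rho>)" using y by (simp add: powr_def)
  finally have "(1 + (\<rho> - 1) / (x + 1)) * (x + 1) powr (1 - \<rho>) \<le> y powr (1 - \<rho>) * (x + 1) powr (1 - \<rho>)"
    by (rule mult_right_mono) simp
  also have "\<dots> = x powr (1 - \<rho>)" using x by (simp add: y_def powr_divide)
  finally have "(\<rho> - 1) * ((x + 1) powr (1 - \<rho>) / (x + 1)) \<le> x powr (1 - \<rho>) - (x + 1) powr (1 - \<rho>)"
    by (simp add: algebra_simps)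
  also have "(x + 1) powr (1 - \<rho>) / (x + 1) = (x + 1) powr (- \<rho>)"
    using x powr_add[of "x + 1" 1 "- \<rho>"] by simp
  finally show ?thesis .
qed

text \<open>The subtracted term at \<open>n + N\<close> carries the induction on \<open>N\<close>;
  dropping it later leaves a bound uniform in \<open>N\<close>.\<close>

lemma sum_powr_tail_le:
  fixes \<rho> :: real and n N :: nat
  assumes n: "n \<ge> 1" and \<rho>: "\<rho> > 1"
  shows "(\<rho> - 1) * (\<Sum>j=n+1..n+N. real j powr (- \<rho>)) \<le> real n powr (1 - \<rho>) - real (n + N) powr (1 - \<rho>)"
proof (induction N)
  case (Suc N)
  have "(\<rho> - 1) * (\<Sum>j=n+1..n+Suc N. real j powr (- \<rho>))
      = (\<rho> - 1) * (\<Sum>j=n+1..n+N. real j powr (- \<rho>)) + (\<rho> - 1) * (real (n + N) + 1) powr (- \<rho>)"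
    by (simp add: algebra_simps)
  also have "\<dots> \<le> real n powr (1 - \<rho>) - (real (n + N) + 1) powr (1 - \<rho>)"
    using Suc.IH powr_telescope[of "real (n + N)" \<rho>] n \<rho> by simp
  finally show ?case by (simp add: algebra_simps)
qed simp

lemma prod_powr_atLeastAtMost_fact: "(\<Prod>j=1..n. real j powr \<rho>) = fact n powr \<rho>"
  by (induction n) (auto simp: powr_mult mult.commute)

lemma powr_power_commute:
  fixes x a :: real
  assumes "x \<ge> 0"
  shows "(x ^ n) powr a = (x powr a) ^ n"
  using assms by (induction n) (auto simp: powr_mult)

text \<open>One term of the nonnegative exponential series. At x = n it gives n^n / n! <= e^n, which
  takes the place of Stirling's formula in the upper bound.\<close>

lemma power_div_fact_le_exp:
  fixes x :: real
  assumes "x \<ge> 0"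
  shows "x ^ n / fact n \<le> exp x"
  using sum_le_suminf[OF summable_exp[of x], of "{n}"] assms
  by (simp add: exp_def divide_inverse mult.commute)

text \<open>The factors are split at j = n. For j <= n each is at most 2 (n/j)^\<rho>, with product
  2^n (n^n / n!)^\<rho> <= e^n e^(\<rho> n). For j > n, 1 + x <= e^x and the exponents sum to at
  most n / (\<rho> - 1). The resulting exponent is linear in n and free of \<open>N\<close>.\<close>

lemma prod_one_plus_powr_le_exp:
  fixes \<rho> :: real and n N :: nat
  assumes \<rho>: "\<rho> > 1"
  shows "(\<Prod>j=1..N. 1 + (real n / real j) powr \<rho>) \<le> exp ((1 + \<rho> + 1 / (\<rho> - 1)) * real n)"
proof (cases "n = 0")
  case False
  hence n: "n \<ge> 1" by simp
  let ?f = "\<lambda>j. 1 + (real n / real j) powr \<rho>"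
  \<comment> \<open>All factors are at least 1, so the product may be lengthened to n + N factors;
    the split at n is then possible even if N < n.\<close>
  have "(\<Prod>j=1..N. ?f j) \<le> (\<Prod>j=1..n+N. ?f j)"
    by (rule prod_mono2) auto
  also have "\<dots> = (\<Prod>j=1..n. ?f j) * (\<Prod>j=n+1..n+N. ?f j)"
    using prod.ub_add_nat[of 1 n ?f N] by simp
  also have "\<dots> \<le> exp ((1 + \<rho>) * real n) * exp (real n / (\<rho> - 1))"
  proof (rule mult_mono)
    have "(\<Prod>j=1..n. ?f j) \<le> (\<Prod>j=1..n. 2 * (real n powr \<rho> / real j powr \<rho>))"
    proof (rule prod_mono, intro conjI)
      fix j assume j: "j \<in> {1..n}"
      have "1 \<le> (real n / real j) powr \<rho>" using j \<rho> by (intro ge_one_powr_ge_zero) auto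
      thus "?f j \<le> 2 * (real n powr \<rho> / real j powr \<rho>)" by (simp add: powr_divide)
    qed (simp add: add_nonneg_nonneg)
    also have "\<dots> = 2 ^ n * (real n ^ n / fact n) powr \<rho>"
      using n prod_powr_atLeastAtMost_fact[of \<rho> n]
      by (simp add: prod.distrib prod_dividef powr_divide powr_power powr_powr flip: powr_realpow)
        (simp add: mult.commute)
    also have "\<dots> \<le> exp (real n) * exp (real n) powr \<rho>"
    proof (rule mult_mono)
      have "(2::real) ^ n \<le> exp 1 ^ n"
        using exp_ge_add_one_self[of 1] by (intro power_mono) auto
      thus "2 ^ n \<le> exp (real n)" by (simp flip: exp_of_nat_mult)
      show "(real n ^ n / fact n) powr \<rho> \<le> exp (real n) powr \<rho>"
        using \<rho> by (intro powr_mono2 power_div_fact_le_exp) auto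
    qed auto
    also have "\<dots> = exp ((1 + \<rho>) * real n)" by (simp add: powr_def flip: exp_add) (simp add: algebra_simps)
    finally show "(\<Prod>j=1..n. ?f j) \<le> exp ((1 + \<rho>) * real n)" .
    have "(\<Prod>j=n+1..n+N. ?f j) \<le> (\<Prod>j=n+1..n+N. exp ((real n / real j) powr \<rho>))"
      by (rule prod_mono) (simp add: add_nonneg_nonneg)
    also have "\<dots> = exp (\<Sum>j=n+1..n+N. (real n / real j) powr \<rho>)" by (simp add: exp_sum)
    also have "(\<Sum>j=n+1..n+N. (real n / real j) powr \<rho>) = real n powr \<rho> * (\<Sum>j=n+1..n+N. real j powr (- \<rho>))"
      by (simp add: powr_divide powr_minus_divide sum_distrib_left)
    also have "\<dots> \<le> real n powr \<rho> * (real n powr (1 - \<rho>) / (\<rho> - 1))"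
    proof (rule mult_left_mono)
      have "(\<rho> - 1) * (\<Sum>j=n+1..n+N. real j powr (- \<rho>)) \<le> real n powr (1 - \<rho>)"
        using sum_powr_tail_le[OF n \<rho>, of N] by (rule order_trans) simp
      thus "(\<Sum>j=n+1..n+N. real j powr (- \<rho>)) \<le> real n powr (1 - \<rho>) / (\<rho> - 1)"
        using \<rho> by (simp add: field_simps)
    qed simp
    also have "\<dots> = real n / (\<rho> - 1)"
      using n by (simp flip: powr_add)
    finally show "(\<Prod>j=n+1..n+N. ?f j) \<le> exp (real n / (\<rho> - 1))" by simp
  qed (auto intro!: prod_nonneg add_nonneg_nonneg)
  also have "\<dots> = exp ((1 + \<rho> + 1 / (\<rho> - 1)) * real n)"
    by (simp add: algebra_simps flip: exp_add)
  finally show ?thesis .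
qed simp

section \<open>Generating function of the multi-indices\<close>

text \<open>Expanding the product on the right, each j contributes either 1 (j is not in v) or one
  term \<open>f j k\<close> (j is in v and \<nu>_j = k).\<close>

lemma sum_PiE_Pow_prod:
  fixes f :: "'a \<Rightarrow> 'b \<Rightarrow> real"
  assumes "finite A" "finite B"
  shows "(\<Sum>v\<in>Pow A. \<Sum>\<nu>\<in>PiE v (\<lambda>_. B). \<Prod>j\<in>v. f j (\<nu> j)) = (\<Prod>j\<in>A. 1 + (\<Sum>k\<in>B. f j k))"
proof -
  have "(\<Prod>j\<in>A. (\<Sum>k\<in>B. f j k) + 1) = (\<Sum>v\<in>Pow A. \<Prod>j\<in>v. \<Sum>k\<in>B. f j k)"
    using assms by (subst prod_add) auto
  also have "\<dots> = (\<Sum>v\<in>Pow A. \<Sum>\<nu>\<in>PiE v (\<lambda>_. B). \<Prod>j\<in>v. f j (\<nu> j))"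
    using assms by (intro sum.cong refl prod_sum_PiE) (auto intro: finite_subset)
  finally show ?thesis by (simp add: add.commute)
qed

text \<open>Passing from n to n + 1 adds x^(n+1) on the left and x (1 + x)^n on the right. This
  reduces the generating function with powers up to \<alpha> to the \<alpha>-th power of the one
  with linear factors.\<close>

lemma one_plus_sum_power_le:
  fixes x :: real
  assumes "x \<ge> 0"
  shows "1 + (\<Sum>k=1..n. x ^ k) \<le> (1 + x) ^ n"
proof (induction n)
  case (Suc n)
  have "x ^ Suc n \<le> (1 + x) ^ n * x" using assms by (simp add: mult.commute power_mono mult_left_mono)
  thus ?case using Suc.IH by (simp add: algebra_simps)
qed simp

text \<open>Cauchy's estimate for the coefficients of the generating function, at the radius \<^term>\<open>n powr \<rho>\<close>.\<close>
lemma sum_multiindex_le: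
  fixes \<rho> :: real and n N \<alpha> :: nat
  assumes \<rho>: "\<rho> > 1"
  shows "(\<Sum>v\<in>Pow {1..N}. \<Sum>\<nu>\<in>PiE v (\<lambda>_. {1..\<alpha>}). \<Prod>j\<in>v. ((real n / real j) powr \<rho>) ^ \<nu> j)
         \<le> exp (real \<alpha> * (1 + \<rho> + 1 / (\<rho> - 1))) ^ n"
proof -
  have "(\<Sum>v\<in>Pow {1..N}. \<Sum>\<nu>\<in>PiE v (\<lambda>_. {1..\<alpha>}). \<Prod>j\<in>v. ((real n / real j) powr \<rho>) ^ \<nu> j)
      = (\<Prod>j=1..N. 1 + (\<Sum>k=1..\<alpha>. ((real n / real j) powr \<rho>) ^ k))"
    by (intro sum_PiE_Pow_prod) auto
  also have "\<dots> \<le> (\<Prod>j=1..N. (1 + (real n / real j) powr \<rho>) ^ \<alpha>)"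
    by (intro prod_mono conjI one_plus_sum_power_le add_nonneg_nonneg sum_nonneg) auto
  also have "\<dots> = (\<Prod>j=1..N. 1 + (real n / real j) powr \<rho>) ^ \<alpha>" by (simp add: prod_power_distrib)
  also have "\<dots> \<le> exp ((1 + \<rho> + 1 / (\<rho> - 1)) * real n) ^ \<alpha>"
    by (intro power_mono prod_one_plus_powr_le_exp \<rho> prod_nonneg add_nonneg_nonneg) auto
  also have "\<dots> = exp (real \<alpha> * (1 + \<rho> + 1 / (\<rho> - 1))) ^ n"
    by (simp add: mult_ac flip: exp_of_nat_mult)
  finally show ?thesis .
qed


section \<open>Basic properties of the weights\<close>

text \<open>For empty v there is exactly one multi-index, and its summand is (0!)^\<sigma> times an
  empty product, that is 1; so the separate case in \<open>weight\<close> fits the general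
  formula.\<close>

lemma weight_conv_sum:
  assumes "finite v"
  shows "weight \<alpha> \<rho> \<sigma> \<Upsilon> v = (\<Sum>\<nu> \<in> PiE v (\<lambda>_. {1..\<alpha>}).
           (fact (\<Sum>j\<in>v. \<nu> j)) powr \<sigma> * (\<Prod>j\<in>v. \<Upsilon> (\<nu> j) / (real j powr (real (\<nu> j) * \<rho>))))"
  by (cases "v = {}") (auto simp: weight_def)

lemma weight_nonneg:
  assumes "finite v" "\<And>k. k \<in> {1..\<alpha>} \<Longrightarrow> \<Upsilon> k > 0"
  shows "weight \<alpha> \<rho> \<sigma> \<Upsilon> v \<ge> 0"
  unfolding weight_conv_sum[OF assms(1)]
  by (intro sum_nonneg mult_nonneg_nonneg prod_nonneg divide_nonneg_nonneg)
    (auto intro!: less_imp_le assms(2) simp: PiE_iff)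

text \<open>The summands are nonnegative, so the one at \<nu> = (1,...,1) is a lower bound; there
  |\<nu>| = n and the denominators multiply to (n!)^\<rho>.\<close>

lemma weight_atLeastAtMost_ge:
  assumes "\<alpha> \<ge> 1" "\<And>k. k \<in> {1..\<alpha>} \<Longrightarrow> \<Upsilon> k > 0"
  shows "weight \<alpha> \<rho> \<sigma> \<Upsilon> {1..n} \<ge> fact n powr (\<sigma> - \<rho>) * \<Upsilon> 1 ^ n"
proof -
  let ?f = "\<lambda>\<nu>. (fact (\<Sum>j\<in>{1..n}. \<nu> j)) powr \<sigma> * (\<Prod>j\<in>{1..n}. \<Upsilon> (\<nu> j) / (real j powr (real (\<nu> j) * \<rho>)))"
  define \<nu> :: "nat \<Rightarrow> nat" where "\<nu> = (\<lambda>j\<in>{1..n}. 1)"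
  have \<nu>: "\<nu> j = 1" if "j \<in> {1..n}" for j using that by (simp add: \<nu>_def)
  have "?f \<nu> \<le> (\<Sum>\<nu>\<in>PiE {1..n} (\<lambda>_. {1..\<alpha>}). ?f \<nu>)"
  proof (rule member_le_sum)
    show "\<nu> \<in> PiE {1..n} (\<lambda>_. {1..\<alpha>})" using assms(1) by (auto simp: \<nu>_def)
    show "0 \<le> ?f \<mu>" if "\<mu> \<in> PiE {1..n} (\<lambda>_. {1..\<alpha>}) - {\<nu>}" for \<mu>
      using that by (intro mult_nonneg_nonneg prod_nonneg divide_nonneg_nonneg)
        (auto intro!: less_imp_le assms(2) simp: PiE_iff)
  qed (auto intro!: finite_PiE)
  also have "(\<Sum>j\<in>{1..n}. \<nu> j) = n" using \<nu> by simp
  also have "(\<Prod>j\<in>{1..n}. \<Upsilon> (\<nu> j) / (real j powr (real (\<nu> j) * \<rho>))) = (\<Prod>j\<in>{1..n}. \<Upsilon> 1 / (real j powr \<rho>))"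
    using \<nu> by (intro prod.cong) auto
  also have "\<dots> = \<Upsilon> 1 ^ n / fact n powr \<rho>"
    using prod_powr_atLeastAtMost_fact[of \<rho> n] by (simp add: prod_dividef)
  finally show ?thesis by (simp add: weight_conv_sum powr_diff)
qed

section \<open>Upper bound for S\<close>

text \<open>Prepares Cauchy's estimate: (n!)^\<sigma> is written as (n!)^(-(\<rho> - \<sigma>))
  (n!)^\<rho>, and n! <= n^n turns the last factor into powers of the radius n^\<rho>. Since every
  \<nu>_j >= 1 and m >= 1, m^|v| is at most m^n, so m, M and the radius all occur to the power
  n.\<close>

lemma multiindex_term_le:
  fixes \<rho> \<sigma> m M :: real and \<Upsilon> :: "nat \<Rightarrow> real"
  assumes v: "finite v" "0 \<notin> v" and \<nu>: "\<And>j. j \<in> v \<Longrightarrow> \<nu> j \<in> {1..\<alpha>}"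
    and \<Upsilon>: "\<And>k. k \<in> {1..\<alpha>} \<Longrightarrow> 0 < \<Upsilon> k \<and> \<Upsilon> k \<le> M ^ k"
    and m: "m \<ge> 1" and M: "M > 0" and \<rho>: "\<rho> > 0" and n: "n = (\<Sum>j\<in>v. \<nu> j)"
  shows "(fact n) powr \<sigma> * (\<Prod>j\<in>v. \<Upsilon> (\<nu> j) / (real j powr (real (\<nu> j) * \<rho>))) * m ^ card v
    \<le> fact n powr (- (\<rho> - \<sigma>)) * (m * M) ^ n * (\<Prod>j\<in>v. ((real n / real j) powr \<rho>) ^ \<nu> j)"
proof -
  have "card v \<le> n" unfolding n using sum_mono[of v "\<lambda>_. 1" \<nu>] \<nu> by force
  hence mle: "m ^ card v \<le> m ^ n" using m by (intro power_increasing) auto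
  have "(\<Prod>j\<in>v. \<Upsilon> (\<nu> j) / (real j powr (real (\<nu> j) * \<rho>)))
      \<le> (\<Prod>j\<in>v. M ^ \<nu> j * (1 / real j powr \<rho>) ^ \<nu> j)"
  proof (rule prod_mono, intro conjI)
    fix j assume j: "j \<in> v"
    have "real j powr (real (\<nu> j) * \<rho>) = (real j powr \<rho>) ^ \<nu> j"
      using j v by (subst powr_realpow[symmetric]) (auto simp: powr_powr mult.commute intro!: gr0I)
    thus "\<Upsilon> (\<nu> j) / (real j powr (real (\<nu> j) * \<rho>)) \<le> M ^ \<nu> j * (1 / real j powr \<rho>) ^ \<nu> j"
      using \<Upsilon>[OF \<nu>[OF j]] by (simp add: power_divide divide_right_mono)
    show "0 \<le> \<Upsilon> (\<nu> j) / (real j powr (real (\<nu> j) * \<rho>))"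
      using \<Upsilon>[OF \<nu>[OF j]] by simp
  qed
  also have "\<dots> = M ^ n * (\<Prod>j\<in>v. (1 / real j powr \<rho>) ^ \<nu> j)"
    by (simp add: prod.distrib n power_sum)
  finally have le: "(\<Prod>j\<in>v. \<Upsilon> (\<nu> j) / (real j powr (real (\<nu> j) * \<rho>))) \<le> \<dots>" .
  let ?P = "\<Prod>j\<in>v. (1 / real j powr \<rho>) ^ \<nu> j"
  have P: "?P \<ge> 0" by (intro prod_nonneg) auto
  have "(fact n :: real) \<le> real n ^ n" using fact_le_power[of n, where 'a = real] by simp
  hence "fact n powr \<rho> \<le> (real n ^ n) powr \<rho>"
    using \<rho> by (intro powr_mono2) auto
  also have "\<dots> = (real n powr \<rho>) ^ n"
    by (simp add: powr_power_commute)
  finally have fact: "fact n powr \<rho> \<le> (real n powr \<rho>) ^ n" .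
  have "(fact n) powr \<sigma> * (\<Prod>j\<in>v. \<Upsilon> (\<nu> j) / (real j powr (real (\<nu> j) * \<rho>))) * m ^ card v
      \<le> (fact n) powr \<sigma> * (M ^ n * ?P) * m ^ n"
    using mle le P M m by (intro mult_mono mult_left_mono) auto
  also have "\<dots> = fact n powr (- (\<rho> - \<sigma>)) * (m * M) ^ n * (fact n powr \<rho> * ?P)"
    by (simp add: power_mult_distrib powr_diff)
  also have "\<dots> \<le> fact n powr (- (\<rho> - \<sigma>)) * (m * M) ^ n * ((real n powr \<rho>) ^ n * ?P)"
    using fact P M m by (intro mult_left_mono mult_right_mono) auto
  \<comment> \<open>The exponent n is the sum of the \<nu>_j, so the radius is distributed over v
    with \<nu>_j copies at each j; the base n stays.\<close>
  also have "(real n powr \<rho>) ^ n * ?P = (\<Prod>j\<in>v. ((real n / real j) powr \<rho>) ^ \<nu> j)"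
    by (subst (2) n) (simp add: power_sum powr_divide power_divide flip: prod.distrib)
  finally show ?thesis .
qed

text \<open>The factor \<^term>\<open>2 ^ n\<close> makes the series over \<^term>\<open>n\<close> summable; since \<^term>\<open>\<tau>\<close> is only an exponent of
  \<^term>\<open>2 * x\<close>, the loss is absorbed by the constant of the theorem.\<close>
lemma power_div_fact_powr_le:
  fixes x \<tau> :: real
  assumes x: "x > 0" and \<tau>: "\<tau> > 0"
  shows "fact n powr (- \<tau>) * x ^ n \<le> (1 / 2) ^ n * exp (\<tau> * (2 * x) powr (1 / \<tau>))"
proof -
  \<comment> \<open>\<open>y\<close> solves y^\<tau> = 2x, which turns (2x)^n / (n!)^\<tau> into the
    \<tau>-th power of a term of the exponential series.\<close>
  define y where "y = (2 * x) powr (1 / \<tau>)"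
  have y: "y > 0" "y powr \<tau> = 2 * x" using x \<tau> by (auto simp: y_def powr_powr)
  have "(2 * x) ^ n = (y ^ n) powr \<tau>"
    using y by (simp add: powr_power_commute)
  hence "fact n powr (- \<tau>) * (2 * x) ^ n = (y ^ n / fact n) powr \<tau>"
    using y by (simp add: powr_divide powr_minus_divide)
  also have "\<dots> \<le> exp y powr \<tau>"
    using y \<tau> by (intro powr_mono2 power_div_fact_le_exp) auto
  also have "\<dots> = exp (\<tau> * y)" by (simp add: powr_def)
  finally show ?thesis by (simp add: y_def power_mult_distrib field_simps)
qed

text \<open>The pairs (v, \<nu>) are grouped by n = |\<nu>|, because the radius n^\<rho> may be
  chosen separately for each n. The group of n contributes at most 2^(-n) times a fixed exponential,
  and the geometric series gives the outer factor 2.\<close>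

lemma sum_Pow_weight_le:
  fixes \<rho> \<sigma> m M :: real and \<Upsilon> :: "nat \<Rightarrow> real"
  assumes \<Upsilon>: "\<And>k. k \<in> {1..\<alpha>} \<Longrightarrow> 0 < \<Upsilon> k \<and> \<Upsilon> k \<le> M ^ k"
    and m: "m \<ge> 1" and M: "M > 0" and \<rho>: "\<rho> > 1" "\<rho> > \<sigma>"
  defines "K \<equiv> exp (real \<alpha> * (1 + \<rho> + 1 / (\<rho> - 1)))"
  shows "(\<Sum>v\<in>Pow {1..N}. weight \<alpha> \<rho> \<sigma> \<Upsilon> v * m ^ card v)
    \<le> 2 * exp ((\<rho> - \<sigma>) * (2 * K * M * m) powr (1 / (\<rho> - \<sigma>)))"
proof -
  define E where "E = exp ((\<rho> - \<sigma>) * (2 * K * M * m) powr (1 / (\<rho> - \<sigma>)))"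
  define A where "A = (SIGMA v:Pow {1..N}. PiE v (\<lambda>_. {1..\<alpha>}))"
  define w :: "nat set \<times> (nat \<Rightarrow> nat) \<Rightarrow> nat" where "w = (\<lambda>(v, \<nu>). \<Sum>j\<in>v. \<nu> j)"
  define g where "g = (\<lambda>(v, \<nu>). (fact (\<Sum>j\<in>v. \<nu> j)) powr \<sigma> *
     (\<Prod>j\<in>v. \<Upsilon> (\<nu> j) / (real j powr (real (\<nu> j) * \<rho>))) * m ^ card v)"
  define P :: "nat \<Rightarrow> nat set \<times> (nat \<Rightarrow> nat) \<Rightarrow> real"
    where "P = (\<lambda>n (v, \<nu>). \<Prod>j\<in>v. ((real n / real j) powr \<rho>) ^ \<nu> j)"
  have fin: "finite v" if "v \<in> Pow {1..N}" for v using that by (auto intro: finite_subset)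
  have finA: "finite A" unfolding A_def using fin by (intro finite_SigmaI finite_PiE) auto
  have Ppos: "P n p \<ge> 0" for n p by (auto simp: P_def intro!: prod_nonneg split: prod.split)
  have "(\<Sum>v\<in>Pow {1..N}. weight \<alpha> \<rho> \<sigma> \<Upsilon> v * m ^ card v)
      = (\<Sum>v\<in>Pow {1..N}. \<Sum>\<nu>\<in>PiE v (\<lambda>_. {1..\<alpha>}). g (v, \<nu>))"
    by (intro sum.cong refl) (simp add: fin weight_conv_sum g_def sum_distrib_right)
  also have "\<dots> = (\<Sum>p\<in>A. g p)"
    unfolding A_def using fin by (subst sum.Sigma) (auto intro!: finite_PiE)
  also have "\<dots> = (\<Sum>n\<in>w ` A. \<Sum>p\<in>{p\<in>A. w p = n}. g p)"
    using finA by (intro sum.image_gen)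
  also have "\<dots> \<le> (\<Sum>n\<in>w ` A. (1 / 2) ^ n * E)"
  proof (rule sum_mono)
    fix n
    have "(\<Sum>p\<in>{p\<in>A. w p = n}. g p) \<le> (\<Sum>p\<in>{p\<in>A. w p = n}. fact n powr (- (\<rho> - \<sigma>)) * (m * M) ^ n * P n p)"
    proof (rule sum_mono)
      fix p assume p: "p \<in> {p \<in> A. w p = n}"
      obtain v \<nu> where pv: "p = (v, \<nu>)" by (cases p)
      have v: "v \<in> Pow {1..N}" and \<nu>: "\<nu> \<in> PiE v (\<lambda>_. {1..\<alpha>})" and n: "n = (\<Sum>j\<in>v. \<nu> j)"
        using p by (auto simp: pv A_def w_def)
      have "(fact n) powr \<sigma> * (\<Prod>j\<in>v. \<Upsilon> (\<nu> j) / (real j powr (real (\<nu> j) * \<rho>))) * m ^ card v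
        \<le> fact n powr (- (\<rho> - \<sigma>)) * (m * M) ^ n * (\<Prod>j\<in>v. ((real n / real j) powr \<rho>) ^ \<nu> j)"
        using v \<nu> \<rho> by (intro multiindex_term_le[where \<alpha> = \<alpha>] fin \<Upsilon> m M n) auto
      thus "g p \<le> fact n powr (- (\<rho> - \<sigma>)) * (m * M) ^ n * P n p"
        by (simp add: g_def P_def pv flip: n)
    qed
    also have "\<dots> = fact n powr (- (\<rho> - \<sigma>)) * (m * M) ^ n * (\<Sum>p\<in>{p\<in>A. w p = n}. P n p)"
      by (simp add: sum_distrib_left)
    also have "\<dots> \<le> fact n powr (- (\<rho> - \<sigma>)) * (m * M) ^ n * K ^ n"
    proof (rule mult_left_mono)
      \<comment> \<open>Cauchy's estimate for nonnegative coefficients: one homogeneous part is at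
        most the whole generating function at that radius.\<close>
      have "(\<Sum>p\<in>{p\<in>A. w p = n}. P n p) \<le> (\<Sum>p\<in>A. P n p)"
        using finA Ppos by (intro sum_mono2) auto
      also have "\<dots> = (\<Sum>v\<in>Pow {1..N}. \<Sum>\<nu>\<in>PiE v (\<lambda>_. {1..\<alpha>}). P n (v, \<nu>))"
        unfolding A_def using fin by (subst sum.Sigma) (auto intro!: finite_PiE)
      also have "\<dots> \<le> K ^ n"
        using sum_multiindex_le[OF \<rho>(1), where n = n and N = N and \<alpha> = \<alpha>] by (simp add: P_def K_def)
      finally show "(\<Sum>p\<in>{p\<in>A. w p = n}. P n p) \<le> K ^ n" .
    qed (use m M in auto)
    also have "\<dots> = fact n powr (- (\<rho> - \<sigma>)) * (K * M * m) ^ n" by (simp add: power_mult_distrib)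
    also have "\<dots> \<le> (1 / 2) ^ n * E"
      using power_div_fact_powr_le[of "K * M * m" "\<rho> - \<sigma>" n] m M \<rho>
      by (simp add: E_def K_def mult.assoc)
    finally show "(\<Sum>p\<in>{p\<in>A. w p = n}. g p) \<le> (1 / 2) ^ n * E" .
  qed
  also have "\<dots> = (\<Sum>n\<in>w ` A. (1 / 2) ^ n) * E" by (simp add: sum_distrib_right)
  also have "\<dots> \<le> 2 * E"
  proof (rule mult_right_mono)
    have "(\<Sum>n\<in>w ` A. (1 / 2 :: real) ^ n) \<le> (\<Sum>n. (1 / 2) ^ n)"
      using finA by (intro sum_le_suminf summable_geometric) auto
    thus "(\<Sum>n\<in>w ` A. (1 / 2 :: real) ^ n) \<le> 2" by (simp add: suminf_geometric)
  qed (simp add: E_def)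
  finally show ?thesis by (simp add: E_def)
qed

text \<open>A sum in [0,\<infinity>] is the supremum over finite families, and each such family lies
  in \<open>Pow {1..N}\<close> for some N; the previous bound does not depend on N.\<close>

lemma S_weight_le:
  fixes \<rho> \<sigma> m M :: real and \<Upsilon> :: "nat \<Rightarrow> real"
  assumes \<Upsilon>: "\<And>k. k \<in> {1..\<alpha>} \<Longrightarrow> 0 < \<Upsilon> k \<and> \<Upsilon> k \<le> M ^ k"
    and m: "m \<ge> 1" and M: "M > 0" and \<rho>: "\<rho> > 1" "\<rho> > \<sigma>"
  defines "K \<equiv> exp (real \<alpha> * (1 + \<rho> + 1 / (\<rho> - 1)))"
  shows "S_weight \<alpha> \<rho> \<sigma> \<Upsilon> m \<le> ennreal (2 * exp ((\<rho> - \<sigma>) * (2 * K * M * m) powr (1 / (\<rho> - \<sigma>))))"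
  unfolding S_weight_def
proof (subst nonneg_infsum_complete, simp, rule SUP_least)
  let ?f = "\<lambda>v. weight \<alpha> \<rho> \<sigma> \<Upsilon> v * m ^ card v"
  have nn: "?f v \<ge> 0" if "finite v" for v
    using m \<Upsilon> that by (intro mult_nonneg_nonneg weight_nonneg) auto
  fix F assume F: "F \<in> {F. finite F \<and> F \<subseteq> {v :: nat set. finite v \<and> v \<subseteq> {1..}}}"
  hence "finite (\<Union>F)" by auto
  then obtain N where N: "\<Union>F \<subseteq> {..N}" using finite_nat_iff_bounded_le by blast
  have FN: "F \<subseteq> Pow {1..N}"
  proof
    fix v assume "v \<in> F"
    thus "v \<in> Pow {1..N}" using N F by fastforce
  qed
  have "(\<Sum>v\<in>F. ennreal (?f v)) = ennreal (\<Sum>v\<in>F. ?f v)"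
    using F by (intro sum_ennreal nn) auto
  also have "\<dots> \<le> ennreal (\<Sum>v\<in>Pow {1..N}. ?f v)"
    using FN by (intro ennreal_leI sum_mono2 nn) (auto intro: finite_subset)
  also have "\<dots> \<le> ennreal (2 * exp ((\<rho> - \<sigma>) * (2 * K * M * m) powr (1 / (\<rho> - \<sigma>))))"
    unfolding K_def using assms by (intro ennreal_leI sum_Pow_weight_le) auto
  finally show "(\<Sum>v\<in>F. ennreal (?f v)) \<le> \<dots>" .
qed

section \<open>Lower bounds for S, and divergence for \<rho> \<le> \<sigma>\<close>

lemma S_weight_mono:
  assumes "\<And>k. k \<in> {1..\<alpha>} \<Longrightarrow> \<Upsilon> k > 0" "0 \<le> m" "m \<le> m'"
  shows "S_weight \<alpha> \<rho> \<sigma> \<Upsilon> m \<le> S_weight \<alpha> \<rho> \<sigma> \<Upsilon> m'"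
  unfolding S_weight_def
  using assms by (intro infsum_mono nonneg_summable_on_complete ennreal_leI mult_left_mono power_mono weight_nonneg) auto

text \<open>The single set {1..n} already contributes this much. The case n = 0 shows that S >=
  1.\<close>

lemma S_weight_ge:
  assumes "\<alpha> \<ge> 1" "\<And>k. k \<in> {1..\<alpha>} \<Longrightarrow> \<Upsilon> k > 0" "m \<ge> 0"
  shows "ennreal (fact n powr (\<sigma> - \<rho>) * (m * \<Upsilon> 1) ^ n) \<le> S_weight \<alpha> \<rho> \<sigma> \<Upsilon> m"
proof -
  have "fact n powr (\<sigma> - \<rho>) * (m * \<Upsilon> 1) ^ n = fact n powr (\<sigma> - \<rho>) * \<Upsilon> 1 ^ n * m ^ n"
    by (simp add: power_mult_distrib)
  also have "\<dots> \<le> weight \<alpha> \<rho> \<sigma> \<Upsilon> {1..n} * m ^ card {1..n}"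
    using weight_atLeastAtMost_ge[of \<alpha> \<Upsilon> n \<sigma> \<rho>] assms by (simp add: mult_right_mono)
  finally have "ennreal (fact n powr (\<sigma> - \<rho>) * (m * \<Upsilon> 1) ^ n)
      \<le> (\<Sum>v\<in>{{1..n}}. ennreal (weight \<alpha> \<rho> \<sigma> \<Upsilon> v * m ^ card v))"
    by (simp add: ennreal_leI)
  also have "\<dots> \<le> S_weight \<alpha> \<rho> \<sigma> \<Upsilon> m"
    unfolding S_weight_def
    by (subst nonneg_infsum_complete) (auto intro!: SUP_upper2[where i = "{{1..n}}"])
  finally show ?thesis .
qed

text \<open>The choice m = 1 / \<Upsilon>_1 cancels the powers of \<Upsilon>_1, so each of the
  infinitely many sets {1..n} contributes at least (n!)^(\<sigma> - \<rho>) >= 1. This covers the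
  boundary case \<rho> = \<sigma>.\<close>

lemma S_weight_infinite:
  assumes \<alpha>: "\<alpha> \<ge> 1" and \<Upsilon>: "\<And>k. k \<in> {1..\<alpha>} \<Longrightarrow> \<Upsilon> k > 0" and "\<rho> \<le> \<sigma>"
  shows "S_weight \<alpha> \<rho> \<sigma> \<Upsilon> (1 / \<Upsilon> 1) = \<infinity>"
proof -
  let ?m = "1 / \<Upsilon> 1"
  let ?f = "\<lambda>v. ennreal (weight \<alpha> \<rho> \<sigma> \<Upsilon> v * ?m ^ card v)"
  let ?S = "range (\<lambda>n::nat. {1..n})"
  have pos: "\<Upsilon> 1 > 0" using \<alpha> by (intro \<Upsilon>) auto
  have "inj (\<lambda>n::nat. {1..n})"
    by (rule inj_on_inverseI[where g = card]) simp
  hence inf: "infinite ?S" using range_inj_infinite by blast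
  have "infsum ?f ?S = \<infinity>"
  proof (rule infsum_superconst_infinite_ennreal[OF _ _ inf])
    fix v assume "v \<in> ?S"
    then obtain n :: nat where v: "v = {1..n}" by blast
    have "1 \<le> fact n powr (\<sigma> - \<rho>)"
      using assms(3) by (intro ge_one_powr_ge_zero) auto
    also have "\<dots> = fact n powr (\<sigma> - \<rho>) * \<Upsilon> 1 ^ n * ?m ^ n"
      using pos by (simp add: power_divide)
    also have "\<dots> \<le> weight \<alpha> \<rho> \<sigma> \<Upsilon> v * ?m ^ card v"
      using pos unfolding v card_atLeastAtMost diff_Suc_1
      by (intro mult_right_mono weight_atLeastAtMost_ge[OF \<alpha> \<Upsilon>]) auto
    finally show "?f v \<ge> 1" by simp
  qed simp
  moreover have "infsum ?f ?S \<le> S_weight \<alpha> \<rho> \<sigma> \<Upsilon> ?m"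
    unfolding S_weight_def by (intro infsum_mono_neutral nonneg_summable_on_complete) auto
  ultimately show ?thesis by (simp add: top_unique)
qed

text \<open>Damping the exponential series by \<^term>\<open>(w / (1 + w)) ^ n\<close> bounds its largest term from below without Stirling's formula.\<close>
lemma exp_le_of_power_div_fact_le:
  fixes w B :: real
  assumes w: "w \<ge> 0" and B: "\<And>n. w ^ n / fact n \<le> B"
  shows "exp (w - 1) \<le> B * (1 + w)"
proof -
  define q where "q = w / (1 + w)"
  have q: "0 \<le> q" "q < 1" using w by (auto simp: q_def)
  have B0: "B \<ge> 1" using B[of 0] by simp
  \<comment> \<open>Since q w = w - w / (1 + w), the damping costs at most 1 in the exponent, while
    1 / (1 - q) = 1 + w is only linear in w.\<close>
  have "w - 1 \<le> q * w" using w by (simp add: q_def field_simps)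
  hence "exp (w - 1) \<le> exp (q * w)" by simp
  also have "\<dots> = (\<Sum>n. (q * w) ^ n / fact n)" by (simp add: exp_def divide_inverse mult.commute)
  also have "\<dots> \<le> (\<Sum>n. B * q ^ n)"
  proof (rule suminf_le)
    fix n
    have "(w ^ n / fact n) * q ^ n \<le> B * q ^ n" using q by (intro mult_right_mono B) auto
    thus "(q * w) ^ n / fact n \<le> B * q ^ n" by (simp add: power_mult_distrib mult.commute)
  qed (use summable_exp[of "q * w"] q in \<open>auto simp: divide_inverse mult.commute intro!: summable_mult summable_geometric\<close>)
  also have "\<dots> = B * (1 / (1 - q))"
    using q by (subst suminf_mult) (auto simp: suminf_geometric intro!: summable_geometric)
  also have "1 / (1 - q) = 1 + w" using w by (simp add: q_def field_simps)
  finally show ?thesis .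
qed

text \<open>With w^(\<rho> - \<sigma>) = m \<Upsilon>_1 the terms from the sets {1..n} are (w^n /
  n!)^(\<rho> - \<sigma>), so a root of S bounds every term of the exponential series at w.
  Finiteness is assumed because \<open>enn2real\<close> sends \<infinity> to 0.\<close>

lemma ln_S_weight_ge:
  assumes \<alpha>: "\<alpha> \<ge> 1" and \<Upsilon>: "\<And>k. k \<in> {1..\<alpha>} \<Longrightarrow> \<Upsilon> k > 0" and m: "m > 0"
    and \<tau>: "\<rho> > \<sigma>" and fin: "S_weight \<alpha> \<rho> \<sigma> \<Upsilon> m < \<infinity>"
  defines "w \<equiv> (m * \<Upsilon> 1) powr (1 / (\<rho> - \<sigma>))"
  shows "(\<rho> - \<sigma>) * (w - 1 - ln (1 + w)) \<le> ln (enn2real (S_weight \<alpha> \<rho> \<sigma> \<Upsilon> m))"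
proof -
  define s where "s = enn2real (S_weight \<alpha> \<rho> \<sigma> \<Upsilon> m)"
  define \<tau>' where "\<tau>' = \<rho> - \<sigma>"
  have \<tau>': "\<tau>' > 0" using \<tau> by (simp add: \<tau>'_def)
  have pos: "m * \<Upsilon> 1 > 0" using \<alpha> m by (intro mult_pos_pos \<Upsilon>) auto
  have w: "w > 0" "w powr \<tau>' = m * \<Upsilon> 1" using pos \<tau>' by (auto simp: w_def powr_powr \<tau>'_def)
  have le: "(w ^ n / fact n) powr \<tau>' \<le> s" for n
  proof -
    have "(m * \<Upsilon> 1) ^ n = (w ^ n) powr \<tau>'"
      using w by (simp add: powr_power_commute)
    hence "fact n powr (\<sigma> - \<rho>) * (m * \<Upsilon> 1) ^ n = (w ^ n / fact n) powr \<tau>'"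
      using w by (simp add: powr_divide powr_diff \<tau>'_def)
    hence "ennreal ((w ^ n / fact n) powr \<tau>') \<le> S_weight \<alpha> \<rho> \<sigma> \<Upsilon> m"
      using S_weight_ge[of \<alpha> \<Upsilon> m n \<sigma> \<rho>] \<alpha> \<Upsilon> m by simp
    also have "\<dots> = ennreal s" using fin by (simp add: s_def)
    finally show ?thesis by (simp add: s_def)
  qed
  have s: "s \<ge> 1" using le[of 0] by simp
  have "w ^ n / fact n \<le> s powr (1 / \<tau>')" for n
  proof -
    have "w ^ n / fact n = ((w ^ n / fact n) powr \<tau>') powr (1 / \<tau>')"
      using w(1) \<tau>' by (simp add: powr_powr)
    also have "\<dots> \<le> s powr (1 / \<tau>')" using \<tau>' by (intro powr_mono2 le) auto
    finally show ?thesis .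
  qed
  hence "exp (w - 1) \<le> s powr (1 / \<tau>') * (1 + w)"
    using w by (intro exp_le_of_power_div_fact_le) auto
  hence "ln (exp (w - 1)) \<le> ln (s powr (1 / \<tau>') * (1 + w))"
    using s w by (subst ln_le_cancel_iff) auto
  hence "w - 1 \<le> ln s / \<tau>' + ln (1 + w)" using s w by (simp add: ln_mult)
  thus ?thesis using \<tau>' by (simp add: field_simps flip: s_def \<tau>'_def)
qed

section \<open>Growth of log S as m tends to infinity\<close>

text \<open>After division by m^(1/(\<rho> - \<sigma>)) the constant and the logarithmic loss in the
  lower bound tend to 0, which leaves the sharp leading coefficient.\<close>

lemma Liminf_S_weight_ge:
  assumes \<alpha>: "\<alpha> \<ge> 1" and \<Upsilon>: "\<And>k. k \<in> {1..\<alpha>} \<Longrightarrow> \<Upsilon> k > 0"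
    and \<tau>: "\<rho> > \<sigma>" and fin: "\<And>m. m > 0 \<Longrightarrow> S_weight \<alpha> \<rho> \<sigma> \<Upsilon> m < \<infinity>"
  shows "ereal ((\<rho> - \<sigma>) * \<Upsilon> 1 powr (1 / (\<rho> - \<sigma>))) \<le>
    Liminf at_top (\<lambda>m::real. ereal (m powr (- (1 / (\<rho> - \<sigma>))) * ln (enn2real (S_weight \<alpha> \<rho> \<sigma> \<Upsilon> m))))"
proof -
  define p where "p = 1 / (\<rho> - \<sigma>)"
  define u where "u = \<Upsilon> 1 powr p"
  have p: "p > 0" using \<tau> by (simp add: p_def)
  have pos: "\<Upsilon> 1 > 0" using \<alpha> by (intro \<Upsilon>) auto
  hence u: "u > 0" by (simp add: u_def)
  define h where "h = (\<lambda>m::real. m powr (- p) * ((\<rho> - \<sigma>) * (u * m powr p - 1 - ln (1 + u * m powr p))))"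
  have "(h \<longlongrightarrow> (\<rho> - \<sigma>) * u) at_top"
    unfolding h_def using p u \<tau> by real_asymp
  hence "ereal ((\<rho> - \<sigma>) * u) = Liminf at_top (\<lambda>m. ereal (h m))"
    by (intro lim_imp_Liminf[symmetric]) auto
  also have "\<dots> \<le> Liminf at_top (\<lambda>m. ereal (m powr (- p) * ln (enn2real (S_weight \<alpha> \<rho> \<sigma> \<Upsilon> m))))"
  proof (intro Liminf_mono eventually_mono[OF eventually_gt_at_top[of 0]])
    fix m :: real assume m: "m > 0"
    have "(m * \<Upsilon> 1) powr p = u * m powr p" using m pos by (simp add: powr_mult u_def)
    thus "ereal (h m) \<le> ereal (m powr (- p) * ln (enn2real (S_weight \<alpha> \<rho> \<sigma> \<Upsilon> m)))"
      using ln_S_weight_ge[OF \<alpha> \<Upsilon> m \<tau> fin[OF m]] by (simp add: h_def mult_left_mono flip: p_def)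
  qed
  finally show ?thesis by (simp add: u_def p_def)
qed

text \<open>The factor 2 in front of the exponential becomes ln 2 and vanishes after scaling; the 2
  next to K sits inside the power and survives.\<close>

lemma Limsup_S_weight_le:
  fixes \<rho> \<sigma> M :: real and \<Upsilon> :: "nat \<Rightarrow> real"
  assumes \<alpha>: "\<alpha> \<ge> 1" and \<Upsilon>: "\<And>k. k \<in> {1..\<alpha>} \<Longrightarrow> 0 < \<Upsilon> k \<and> \<Upsilon> k \<le> M ^ k"
    and M: "M > 0" and \<rho>: "\<rho> > 1" "\<rho> > \<sigma>"
  defines "K \<equiv> exp (real \<alpha> * (1 + \<rho> + 1 / (\<rho> - 1)))"
  shows "Limsup at_top (\<lambda>m::real. ereal (m powr (- (1 / (\<rho> - \<sigma>))) * ln (enn2real (S_weight \<alpha> \<rho> \<sigma> \<Upsilon> m))))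
    \<le> ereal ((\<rho> - \<sigma>) * (2 * K * M) powr (1 / (\<rho> - \<sigma>)))"
proof -
  define p where "p = 1 / (\<rho> - \<sigma>)"
  define u where "u = (2 * K * M) powr p"
  have p: "p > 0" using \<rho> by (simp add: p_def)
  have KM: "2 * K * M > 0" using M by (simp add: K_def)
  hence u: "u > 0" by (simp only: u_def powr_gt_zero)
  define h where "h = (\<lambda>m::real. m powr (- p) * (ln 2 + (\<rho> - \<sigma>) * (u * m powr p)))"
  have "Limsup at_top (\<lambda>m. ereal (m powr (- p) * ln (enn2real (S_weight \<alpha> \<rho> \<sigma> \<Upsilon> m)))) \<le> Limsup at_top (\<lambda>m. ereal (h m))"
  proof (intro Limsup_mono eventually_mono[OF eventually_ge_at_top[of 1]])
    fix m :: real assume m: "m \<ge> 1"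
    let ?s = "S_weight \<alpha> \<rho> \<sigma> \<Upsilon> m"
    have le: "?s \<le> ennreal (2 * exp ((\<rho> - \<sigma>) * (u * m powr p)))"
      using S_weight_le[OF \<Upsilon> m M \<rho>] m KM by (simp add: powr_mult u_def K_def p_def)
    \<comment> \<open>S is finite and at least 1, so its real value is positive and the logarithms
      can be compared.\<close>
    have "ennreal 1 \<le> ?s" using S_weight_ge[of \<alpha> \<Upsilon> m 0 \<sigma> \<rho>] \<alpha> \<Upsilon> m by simp
    moreover have "?s < \<infinity>" using le by (rule order_le_less_trans) simp
    ultimately have "enn2real ?s \<ge> 1"
      using enn2real_mono[of 1 ?s] by simp
    moreover have "enn2real ?s \<le> 2 * exp ((\<rho> - \<sigma>) * (u * m powr p))"
      using le by (intro enn2real_leI) auto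
    ultimately have "ln (enn2real ?s) \<le> ln (2 * exp ((\<rho> - \<sigma>) * (u * m powr p)))"
      by (subst ln_le_cancel_iff) auto
    hence "ln (enn2real ?s) \<le> ln 2 + (\<rho> - \<sigma>) * (u * m powr p)" by (simp add: ln_mult)
    thus "ereal (m powr (- p) * ln (enn2real ?s)) \<le> ereal (h m)"
      by (simp add: h_def mult_left_mono)
  qed
  also have "(h \<longlongrightarrow> (\<rho> - \<sigma>) * u) at_top"
    unfolding h_def using p u \<rho> by real_asymp
  hence "Limsup at_top (\<lambda>m. ereal (h m)) = ereal ((\<rho> - \<sigma>) * u)"
    by (intro lim_imp_Limsup) auto
  finally show ?thesis by (simp add: u_def p_def)
qed

theorem theorem5:
  fixes \<alpha> :: nat and \<rho> :: real
  assumes "\<alpha> \<ge> 1" and "\<rho> > 1"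
  shows "\<exists>C::real. C > 0 \<and>
    (\<forall>(\<sigma>::real) (\<Upsilon>::nat \<Rightarrow> real). \<sigma> \<ge> 0 \<longrightarrow> (\<forall>k\<in>{1..\<alpha>}. \<Upsilon> k > 0) \<longrightarrow>
      ((\<forall>m>0. S_weight \<alpha> \<rho> \<sigma> \<Upsilon> m < \<infinity>) \<longleftrightarrow> \<rho> > \<sigma>) \<and>
      (\<rho> > \<sigma> \<longrightarrow>
        Liminf at_top (\<lambda>m::real. ereal (m powr (- (1 / (\<rho> - \<sigma>))) *
            ln (enn2real (S_weight \<alpha> \<rho> \<sigma> \<Upsilon> m))))
          \<ge> ereal ((\<rho> - \<sigma>) * \<Upsilon> 1 powr (1 / (\<rho> - \<sigma>))) \<and>
        Limsup at_top (\<lambda>m::real. ereal (m powr (- (1 / (\<rho> - \<sigma>))) *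
            ln (enn2real (S_weight \<alpha> \<rho> \<sigma> \<Upsilon> m))))
          \<le> ereal ((\<rho> - \<sigma>) *
              (C * (MAX k\<in>{1..\<alpha>}. \<Upsilon> k powr (1 / real k))) powr (1 / (\<rho> - \<sigma>)))))"
proof (intro exI conjI allI impI)
  \<comment> \<open>The constant is C = 2K: K comes from Cauchy's estimate, 2 from making the series
    over n geometric. It is fixed before \<sigma> and \<Upsilon>.\<close>
  let ?K = "exp (real \<alpha> * (1 + \<rho> + 1 / (\<rho> - 1)))"
  show "2 * ?K > 0" by simp
  fix \<sigma> :: real and \<Upsilon> :: "nat \<Rightarrow> real"
  assume "\<forall>k\<in>{1..\<alpha>}. \<Upsilon> k > 0"
  hence \<Upsilon>: "\<Upsilon> k > 0" if "k \<in> {1..\<alpha>}" for k using that by blast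
  define M where "M = (MAX k\<in>{1..\<alpha>}. \<Upsilon> k powr (1 / real k))"
  have leM: "\<Upsilon> k powr (1 / real k) \<le> M" if "k \<in> {1..\<alpha>}" for k
    unfolding M_def using that by (intro Max_ge) auto
  have "0 < \<Upsilon> 1 powr (1 / real 1)" using \<Upsilon>[of 1] assms(1) by simp
  hence M: "M > 0" using leM[of 1] assms(1) by simp
  have \<Upsilon>M: "0 < \<Upsilon> k \<and> \<Upsilon> k \<le> M ^ k" if "k \<in> {1..\<alpha>}" for k
  proof -
    have "\<Upsilon> k = (\<Upsilon> k powr (1 / real k)) ^ k" using \<Upsilon>[OF that] that by (simp add: powr_power)
    also have "\<dots> \<le> M ^ k" using leM[OF that] by (intro power_mono) auto
    finally show ?thesis using \<Upsilon>[OF that] by simp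
  qed
  have fin: "S_weight \<alpha> \<rho> \<sigma> \<Upsilon> m < \<infinity>" if "\<rho> > \<sigma>" "m > 0" for m
  proof -
    \<comment> \<open>The upper bound is available for m >= 1; monotonicity in m covers smaller
      values.\<close>
    have "S_weight \<alpha> \<rho> \<sigma> \<Upsilon> m \<le> S_weight \<alpha> \<rho> \<sigma> \<Upsilon> (max m 1)"
      using that \<Upsilon> by (intro S_weight_mono) auto
    also have "\<dots> \<le> ennreal (2 * exp ((\<rho> - \<sigma>) * (2 * ?K * M * max m 1) powr (1 / (\<rho> - \<sigma>))))"
      using that by (intro S_weight_le \<Upsilon>M M assms(2)) auto
    also have "\<dots> < \<infinity>" by simp
    finally show ?thesis .
  qed
  show "(\<forall>m>0. S_weight \<alpha> \<rho> \<sigma> \<Upsilon> m < \<infinity>) \<longleftrightarrow> \<rho> > \<sigma>"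
  proof
    assume *: "\<forall>m>0. S_weight \<alpha> \<rho> \<sigma> \<Upsilon> m < \<infinity>"
    have "1 / \<Upsilon> 1 > 0" using \<Upsilon>[of 1] assms(1) by simp
    with * have "S_weight \<alpha> \<rho> \<sigma> \<Upsilon> (1 / \<Upsilon> 1) < \<infinity>" by blast
    thus "\<rho> > \<sigma>" using S_weight_infinite[of \<alpha> \<Upsilon> \<rho> \<sigma>] assms(1) \<Upsilon> by (cases "\<rho> \<le> \<sigma>") simp_all
  qed (use fin in blast)
  assume \<tau>: "\<rho> > \<sigma>"
  show "Liminf at_top (\<lambda>m::real. ereal (m powr (- (1 / (\<rho> - \<sigma>))) *
            ln (enn2real (S_weight \<alpha> \<rho> \<sigma> \<Upsilon> m))))
          \<ge> ereal ((\<rho> - \<sigma>) * \<Upsilon> 1 powr (1 / (\<rho> - \<sigma>)))"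
    using Liminf_S_weight_ge[OF assms(1) \<Upsilon> \<tau> fin[OF \<tau>]] by simp
  show "Limsup at_top (\<lambda>m::real. ereal (m powr (- (1 / (\<rho> - \<sigma>))) *
            ln (enn2real (S_weight \<alpha> \<rho> \<sigma> \<Upsilon> m))))
          \<le> ereal ((\<rho> - \<sigma>) *
              (2 * ?K * (MAX k\<in>{1..\<alpha>}. \<Upsilon> k powr (1 / real k))) powr (1 / (\<rho> - \<sigma>)))"
    using Limsup_S_weight_le[OF assms(1) \<Upsilon>M M assms(2) \<tau>] by (simp add: M_def)
qed

end
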